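(* The following filtering strategy for mining maximal co-occurrence rules with prefix pattern (rule antecedent) $\mathbf{p}$ is correct and complete. Filtering strategy: if the support of the pattern $\mathbf{p}$ in a sequence $\mathbf{s}$ is zero, i.e. $\mathrm{sup}(\mathbf{p},\mathbf{s})=0$, then the sequence $\mathbf{s}$ can be pruned.
   Context: Let $\Sigma$ be a set of items. A sequence of length $n$ is $\mathbf{s}=s_1s_2\cdots s_n$ with each $s_i\in\Sigma$. A sequence database is a set of sequences $D=\{\mathbf{s}_1,\dots,\mathbf{s}_k\}$. A pattern of length $m$ is $\mathbf{p}=p_1[a,b]p_2\cdots[a,b]p_m$, abbreviated $p_1p_2\cdots p_m$ with gap $[a,b]$, where the integers $0\le a\le b$ are the minimum and maximum numbers of wildcards between $p_j$ and $p_{j+1}$. An occurrence of $\mathbf{p}$ in $\mathbf{s}$ is a tuple of positions $\langle l_1,\dots,l_m\rangle$ in $\{1,\dots,n\}$ with $p_j=s_{l_j}$ for all $j$ and $a\le l_j-l_{j-1}-1\le b$ for $2\le j\le m$. Two occurrences $l,l'$ of $\mathbf{p}$ are nonoverlapping if and only if $l_j\ne l'_j$ for every $1\le j\le m$. The support $\mathrm{sup}(\mathbf{p},\mathbf{s})$ is the number of nonoverlapping occurrences of $\mathbf{p}$ in $\mathbf{s}$; to count them one searches for the minimal (leftmost) nonoverlapping occurrences. For example, in $\mathbf{s}=adbdadcdccabadcd$ the pattern $a[0,3]d$ has the four nonoverlapping occurrences $\langle 1,2\rangle,\langle 5,6\rangle,\langle 11,14\rangle,\langle 13,16\rangle$,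 so its support is $4$. Also $\mathrm{sup}(\mathbf{p},D)=\sum_{i=1}^k\mathrm{sup}(\mathbf{p},\mathbf{s}_i)$. A pattern $\mathbf{q}$ is a superpattern of $\mathbf{p}$ if $\mathbf{q}$ is longer than $\mathbf{p}$ and $\mathbf{p}$ is a prefix of $\mathbf{q}$ (same gap). For patterns $\mathbf{p},\mathbf{r}$, $\mathbf{p}\cdot\mathbf{r}$ denotes concatenation; the co-occurrence rule $\mathbf{p}\to\mathbf{r}$ has antecedent $\mathbf{p}$, consequent $\mathbf{r}$ and confidence $\mathrm{conf}(\mathbf{p}\to\mathbf{r})=\mathrm{sup}(\mathbf{p}\cdot\mathbf{r},D)/\mathrm{sup}(\mathbf{p},D)$. It is strong if $\mathrm{conf}(\mathbf{p}\to\mathbf{r})\ge\mathit{mincf}$ for a predefined threshold $\mathit{mincf}$. A strong rule $\mathbf{p}\to\mathbf{r}$ is a maximal co-occurrence rule if for every superpattern $\mathbf{w}$ of $\mathbf{r}$ the rule $\mathbf{p}\to\mathbf{w}$ is not strong. The mining task is: given a sequence or a sequence database $D$, $\mathit{mincf}$ and the prefix pattern $\mathbf{p}$, discover all maximal co-occurrence rules with antecedent $\mathbf{p}$. "Pruned" means that the sequence is dropped from the database during mining. "Correct and complete" is used informally, without a formal definition. *)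

theory Defs
  imports Complex_Main "HOL-Library.Sublist"
begin

text \<open>
  The items are the elements of the type \<open>'a\<close>. A sequence is a list of items, and a database is a
  finite set of sequences. A pattern is a nonempty list of items; the gap \<open>[a, b]\<close>, common to
  all patterns, is passed separately, so that \<open>p \<cdot> r\<close> (with the gap \<open>[a, b]\<close> also
  between the last item of \<open>p\<close> and the first item of \<open>r\<close>) is list append.
\<close>

text \<open>
  Positions are numbered from 1 while list indices start at 0. The gap condition is stated on
  integers to avoid truncated subtraction.
\<close>

definition occurrence :: "nat \<Rightarrow> nat \<Rightarrow> 'a list \<Rightarrow> 'a list \<Rightarrow> nat list \<Rightarrow> bool" where
  "occurrence a b p s l \<longleftrightarrow>
     length l = length p \<and>
     (\<forall>j < length p. l ! j \<in> {1..length s} \<and> p ! j = s ! (l ! j - 1)) \<and>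
     (\<forall>j. 1 \<le> j \<and> j < length p \<longrightarrow>
        int a \<le> int (l ! j) - int (l ! (j - 1)) - 1 \<and>
        int (l ! j) - int (l ! (j - 1)) - 1 \<le> int b)"

text \<open>Used only for position tuples of the same length.\<close>

definition nonoverlapping :: "nat list \<Rightarrow> nat list \<Rightarrow> bool" where
  "nonoverlapping l l' \<longleftrightarrow> (\<forall>j < length l. l ! j \<noteq> l' ! j)"

text \<open>
  The number of nonoverlapping occurrences is the largest number of occurrences that are
  pairwise nonoverlapping. The maximum exists, as there are only finitely many
  occurrences and the empty set is always a candidate.
\<close>

definition sup_seq :: "nat \<Rightarrow> nat \<Rightarrow> 'a list \<Rightarrow> 'a list \<Rightarrow> nat" where
  "sup_seq a b p s =
     Max {card N | N. N \<subseteq> {l. occurrence a b p s l} \<and> pairwise nonoverlapping N}"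

definition sup_db :: "nat \<Rightarrow> nat \<Rightarrow> 'a list \<Rightarrow> 'a list set \<Rightarrow> nat" where
  "sup_db a b p D = (\<Sum>s\<in>D. sup_seq a b p s)"

definition superpattern :: "'a list \<Rightarrow> 'a list \<Rightarrow> bool" where
  "superpattern q p \<longleftrightarrow> length p < length q \<and> prefix p q"

text \<open>
  If \<open>p\<close> has support 0 in \<open>D\<close>, the quotient is 0 by the convention for division by zero, so for
  a positive threshold no rule with antecedent \<open>p\<close> is strong.
\<close>

definition conf :: "nat \<Rightarrow> nat \<Rightarrow> 'a list set \<Rightarrow> 'a list \<Rightarrow> 'a list \<Rightarrow> real" where
  "conf a b D p r = real (sup_db a b (p @ r) D) / real (sup_db a b p D)"

definition strong_rule ::
    "nat \<Rightarrow> nat \<Rightarrow> real \<Rightarrow> 'a list set \<Rightarrow> 'a list \<Rightarrow> 'a list \<Rightarrow> bool" where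
  "strong_rule a b mincf D p r \<longleftrightarrow> conf a b D p r \<ge> mincf"

definition maximal_rule ::
    "nat \<Rightarrow> nat \<Rightarrow> real \<Rightarrow> 'a list set \<Rightarrow> 'a list \<Rightarrow> 'a list \<Rightarrow> bool" where
  "maximal_rule a b mincf D p r \<longleftrightarrow>
     strong_rule a b mincf D p r \<and>
     (\<forall>w. superpattern w r \<longrightarrow> \<not> strong_rule a b mincf D p w)"

text \<open>The result of the mining task; a rule is the pair of its antecedent and its consequent.\<close>

definition mined_rules ::
    "nat \<Rightarrow> nat \<Rightarrow> real \<Rightarrow> 'a list \<Rightarrow> 'a list set \<Rightarrow> ('a list \<times> 'a list) set" where
  "mined_rules a b mincf p D = {(p, r) | r. r \<noteq> [] \<and> maximal_rule a b mincf D p r}"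

text \<open>
  Replacing the database \<open>D\<close> by \<open>D'\<close> is correct if every rule mined from \<open>D'\<close> is a maximal
  co-occurrence rule for \<open>D\<close>, and complete if no maximal co-occurrence rule for \<open>D\<close> is lost.
\<close>

definition correct_replacement ::
    "nat \<Rightarrow> nat \<Rightarrow> real \<Rightarrow> 'a list \<Rightarrow> 'a list set \<Rightarrow> 'a list set \<Rightarrow> bool" where
  "correct_replacement a b mincf p D D' \<longleftrightarrow>
     mined_rules a b mincf p D' \<subseteq> mined_rules a b mincf p D"

definition complete_replacement ::
    "nat \<Rightarrow> nat \<Rightarrow> real \<Rightarrow> 'a list \<Rightarrow> 'a list set \<Rightarrow> 'a list set \<Rightarrow> bool" where
  "complete_replacement a b mincf p D D' \<longleftrightarrow>
     mined_rules a b mincf p D \<subseteq> mined_rules a b mincf p D'"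

text \<open>
  The filtering strategy permits, but does not force, dropping a sequence in which \<open>p\<close> has
  support 0. Hence it relates \<open>D\<close> to every database obtained by dropping any number of such
  sequences: a single one, all of them, or those found so far at some stage of the mining.
\<close>

definition filtered :: "nat \<Rightarrow> nat \<Rightarrow> 'a list \<Rightarrow> 'a list set \<Rightarrow> 'a list set \<Rightarrow> bool" where
  "filtered a b p D D' \<longleftrightarrow> (\<exists>P \<subseteq> {s \<in> D. sup_seq a b p s = 0}. D' = D - P)"

end

theory Submission imports Defs begin

text \<open>
  Cutting an occurrence of \<open>p \<cdot> r\<close> to its first \<open>|p|\<close> positions gives an occurrence of \<open>p\<close>, and a
  single occurrence already makes the support positive. So a sequence in which \<open>p\<close> has support 0
  contributes 0 to numerator and denominator of every confidence with antecedent \<open>p\<close>; dropping it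
  changes no confidence, hence no set of strong or maximal rules.
\<close>

text \<open>Makes the \<open>Max\<close> in \<open>sup_seq\<close> range over a finite set, as
  \<open>Max_ge\<close> requires.\<close>

lemma finite_occurrences: "finite {l. occurrence a b p s l}"
proof (rule finite_subset)
  show "{l. occurrence a b p s l} \<subseteq> {l. set l \<subseteq> {1..length s} \<and> length l = length p}"
    by (fastforce simp: occurrence_def in_set_conv_nth)
  show "finite {l. set l \<subseteq> {1..length s} \<and> length l = length p}"
    by (simp add: finite_lists_length_eq)
qed

lemma sup_seq_eq_0_iff: "sup_seq a b p s = 0 \<longleftrightarrow> (\<forall>l. \<not> occurrence a b p s l)"
proof
  let ?C = "{card N | N. N \<subseteq> {l. occurrence a b p s l} \<and> pairwise nonoverlapping N}"
  assume *: "sup_seq a b p s = 0"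
  have "?C \<subseteq> card ` Pow {l. occurrence a b p s l}"
    by auto
  then have fin: "finite ?C"
    by (rule finite_subset) (simp add: finite_occurrences)
  show "\<forall>l. \<not> occurrence a b p s l"
  proof (intro allI notI)
    fix l
    assume "occurrence a b p s l"
    \<comment> \<open>A singleton is vacuously pairwise nonoverlapping.\<close>
    then have "card {l} \<in> ?C"
      by (intro CollectI exI[of _ "{l}"]) auto
    then have "card {l} \<le> sup_seq a b p s"
      unfolding sup_seq_def by (rule Max_ge[OF fin])
    with * show False
      by simp
  qed
next
  assume "\<forall>l. \<not> occurrence a b p s l"
  \<comment> \<open>The only candidate left is \<open>N = {}\<close>.\<close>
  then have "{card N | N. N \<subseteq> {l. occurrence a b p s l} \<and> pairwise nonoverlapping N} = {0}"
    by auto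
  then show "sup_seq a b p s = 0"
    by (simp add: sup_seq_def)
qed

lemma occurrence_append_take:
  assumes "occurrence a b (p @ r) s l"
  shows "occurrence a b p s (take (length p) l)"
  using assms unfolding occurrence_def
  by (auto simp: nth_append split: if_splits)

lemma sup_seq_append_eq_0: "sup_seq a b p s = 0 \<Longrightarrow> sup_seq a b (p @ r) s = 0"
  unfolding sup_seq_eq_0_iff using occurrence_append_take by blast

lemma sup_db_append_filtered:
  assumes "finite D" and "filtered a b p D D'"
  shows "sup_db a b (p @ r) D' = sup_db a b (p @ r) D"
  unfolding sup_db_def
proof (rule sum.mono_neutral_left)
  show "D' \<subseteq> D" "\<forall>s\<in>D - D'. sup_seq a b (p @ r) s = 0"
    using assms(2) by (auto simp: filtered_def sup_seq_append_eq_0)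
qed fact

lemma conf_filtered:
  assumes "finite D" and "filtered a b p D D'"
  shows "conf a b D' p r = conf a b D p r"
  \<comment> \<open>The instance \<open>r\<close> treats the numerator; the instance
    \<open>[]\<close> treats the denominator, since \<open>p @ [] = p\<close>.\<close>
  using sup_db_append_filtered[OF assms, of r] sup_db_append_filtered[OF assms, of "[]"]
  by (simp add: conf_def)

theorem theorem2:
  fixes a b :: nat and mincf :: real and p :: "'a list" and D D' :: "'a list set"
  assumes "a \<le> b"
    and "p \<noteq> []"
    and "finite D"
    and "filtered a b p D D'"
  shows "correct_replacement a b mincf p D D' \<and> complete_replacement a b mincf p D D'"
  by (simp add: correct_replacement_def complete_replacement_def mined_rules_def
      maximal_rule_def strong_rule_def conf_filtered[OF assms(3,4)])

end
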